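(* Let $m\geq 1$ and $n\geq 2$, and let $p(m,n)$ be the number of Fibonacci polyominoes with horizontal semiperimeter $m$ and vertical semiperimeter $n$. Then \[ p(m,n)=C_m\binom{n-2}{m-1}+C_{m-1}\binom{n-2}{m-2}, \] where $C_k=\frac{1}{k+1}\binom{2k}{k}$ is the $k$th Catalan number. Moreover, the first term $C_m\binom{n-2}{m-1}$ is the number of those polyominoes whose last (rightmost) column has height at least $2$, and the second term $C_{m-1}\binom{n-2}{m-2}$ is the number of those whose last column has height $1$. In particular, $p(n,n)=C_{n-1}$ for every $n\geq 2$.
   Context: A Fibonacci polyomino is a (nonempty) polyomino, considered up to translation, that is column-convex (each column is a contiguous segment of unit cells) and such that, reading columns from left to right, the bottom cell of each column lies exactly one unit above the bottom cell of the preceding column. Equivalently, it is given by a sequence of column heights $(h_1,\dots,h_m)$, $m\ge 1$, with $h_i\ge 2$ for $1\le i\le m-1$ and $h_m\ge 1$; column $i$ consists of the cells in column position $i$ and rows $i,i+1,\dots,i+h_i-1$. The horizontal (resp. vertical) semiperimeter of a polyomino is half the number of horizontal (resp. vertical) unit edges on its boundary (a boundary edge is a unit edge belonging to exactly one cell). A binomial coefficient $\binom{a}{b}$ with $a\ge 0$ is $0$ if $b<0$ or $b>a$. *)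

theory Defs
  imports Complex_Main
begin

text \<open>The pair \<open>(x, y)\<close> denotes the unit cell \<open>[x, x+1] \<times> [y, y+1]\<close>:
  \<open>x\<close> is the column position and \<open>y\<close> the row.\<close>

type_synonym cell = "int \<times> int"

definition adjacent :: "cell \<Rightarrow> cell \<Rightarrow> bool" where
  "adjacent c d \<longleftrightarrow> \<bar>fst c - fst d\<bar> + \<bar>snd c - snd d\<bar> = 1"

definition polyomino :: "cell set \<Rightarrow> bool" where
  "polyomino P \<longleftrightarrow> finite P \<and> P \<noteq> {} \<and>
     (\<forall>c\<in>P. \<forall>d\<in>P. (c, d) \<in> {(a, b). a \<in> P \<and> b \<in> P \<and> adjacent a b}\<^sup>*)"

definition column :: "cell set \<Rightarrow> int \<Rightarrow> int set" where
  "column P i = {j. (i, j) \<in> P}"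

definition column_convex :: "cell set \<Rightarrow> bool" where
  "column_convex P \<longleftrightarrow> (\<forall>i. \<exists>a b. column P i = {a..b})"

text \<open>Connectedness makes the nonempty columns occupy consecutive positions, so the column
  preceding the one at position \<open>i + 1\<close> is the one at position \<open>i\<close>.\<close>

definition fibonacci_polyomino :: "cell set \<Rightarrow> bool" where
  "fibonacci_polyomino P \<longleftrightarrow> polyomino P \<and> column_convex P \<and>
     (\<forall>i. column P i \<noteq> {} \<longrightarrow> column P (i + 1) \<noteq> {} \<longrightarrow>
        Min (column P (i + 1)) = Min (column P i) + 1)"

text \<open>A horizontal unit edge is named by its left endpoint, a vertical one by its lower endpoint.\<close>

definition horizontal_edges :: "cell \<Rightarrow> (int \<times> int) set" where
  "horizontal_edges c = {(fst c, snd c), (fst c, snd c + 1)}"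

definition vertical_edges :: "cell \<Rightarrow> (int \<times> int) set" where
  "vertical_edges c = {(fst c, snd c), (fst c + 1, snd c)}"

definition horizontal_semiperimeter :: "cell set \<Rightarrow> real" where
  "horizontal_semiperimeter P = real (card {e. \<exists>!c. c \<in> P \<and> e \<in> horizontal_edges c}) / 2"

definition vertical_semiperimeter :: "cell set \<Rightarrow> real" where
  "vertical_semiperimeter P = real (card {e. \<exists>!c. c \<in> P \<and> e \<in> vertical_edges c}) / 2"

definition last_column_height :: "cell set \<Rightarrow> nat" where
  "last_column_height P = card (column P (Max (fst ` P)))"

definition translate :: "int \<times> int \<Rightarrow> cell set \<Rightarrow> cell set" where
  "translate v P = (\<lambda>c. (fst c + fst v, snd c + snd v)) ` P"

definition translation_rel :: "(cell set \<times> cell set) set" where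
  "translation_rel = {(P, Q). \<exists>v. Q = translate v P}"

definition fib_polyominoes :: "nat \<Rightarrow> nat \<Rightarrow> cell set set" where
  "fib_polyominoes m n = {P. fibonacci_polyomino P \<and>
     horizontal_semiperimeter P = real m \<and> vertical_semiperimeter P = real n}"

definition num_fib_polyominoes :: "nat \<Rightarrow> nat \<Rightarrow> nat" where
  "num_fib_polyominoes m n = card (fib_polyominoes m n // translation_rel)"

definition catalan :: "nat \<Rightarrow> real" where
  "catalan k = 1 / (real k + 1) * real ((2 * k) choose k)"

text \<open>The lower index may be negative, where \<open>(choose)\<close> with truncated subtraction on \<open>nat\<close>
  would give the wrong value: \<open>n - 2\<close> over \<open>m - 2\<close> must vanish for \<open>m = 1\<close>.\<close>

definition binom :: "nat \<Rightarrow> int \<Rightarrow> nat" where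
  "binom a b = (if b < 0 then 0 else a choose (nat b))"

lemma equiv_translation_rel: "equiv UNIV translation_rel"
proof (rule equivI)
  show "translation_rel \<subseteq> UNIV \<times> UNIV" by simp
  show "refl translation_rel"
    by (rule refl_onI) (auto simp: translation_rel_def translate_def intro!: exI[of _ 0])
  show "sym translation_rel"
  proof (rule symI)
    fix P Q assume "(P, Q) \<in> translation_rel"
    then obtain v where "Q = translate v P" by (auto simp: translation_rel_def)
    then have "P = translate (- fst v, - snd v) Q"
      by (simp add: translate_def image_image)
    then show "(Q, P) \<in> translation_rel" by (auto simp: translation_rel_def)
  qed
  show "trans translation_rel"
  proof (rule transI)
    fix P Q R assume "(P, Q) \<in> translation_rel" "(Q, R) \<in> translation_rel"
    then obtain v w where "Q = translate v P" "R = translate w Q"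
      by (auto simp: translation_rel_def)
    then have "R = translate (fst v + fst w, snd v + snd w) P"
      by (simp add: translate_def image_image add.assoc)
    then show "(P, R) \<in> translation_rel" by (auto simp: translation_rel_def)
  qed
qed

end

theory Submission
  imports Defs "HOL-Computational_Algebra.Formal_Power_Series"
begin

text \<open>Every row of a polyomino has as many left as right boundary edges, and likewise for columns,
  so for column heights \<open>h\<^sub>1, \<dots>, h\<^sub>m\<close> the horizontal semiperimeter is \<open>m\<close> and the vertical one is
  \<open>n = h\<^sub>1 + (\<Sum>i<m. max 0 (h\<^sub>i\<^sub>+\<^sub>1 + 1 - h\<^sub>i))\<close>.
  Let \<open>A\<^sub>m\<close> be the generating function, in \<open>n - 1\<close>, of the sequences of length \<open>m\<close> with all heights
  at least 2, with \<open>A\<^sub>0 = 1\<close>. Those with all heights at least 3 arise by raising every column by one,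
  which raises \<open>n\<close> by one. Any other splits at its first column of height 2 into a raised sequence on
  the left and an arbitrary one on the right, and \<open>n - 1\<close> exceeds the sum of its values for the two
  parts by one. Hence \<open>(1 - X) A\<^sub>m\<^sub>+\<^sub>1 = X (\<Sum>i\<le>m. A\<^sub>i A\<^sub>m\<^sub>-\<^sub>i)\<close>, and the convolution identity of the
  Catalan numbers gives \<open>A\<^sub>m = C\<^sub>m (X / (1 - X))\<^sup>m\<close>. A last column of height 1 after \<open>m - 1\<close> taller
  ones does not change \<open>n\<close>, which reduces the remaining sequences to \<open>A\<^sub>m\<^sub>-\<^sub>1\<close>.\<close>

section \<open>Catalan numbers\<close>

lemma catalan_0: "catalan 0 = 1"
  by (simp add: catalan_def)

lemma catalan_Suc: "(real k + 2) * catalan (Suc k) = (4 * real k + 2) * catalan k"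
proof -
  have central: "real ((2 * n) choose n) = fact (2 * n) / (fact n * fact n)" for n
    by (simp add: binomial_fact)
  show ?thesis
    unfolding catalan_def central by (simp add: divide_simps) (simp add: algebra_simps)
qed

lemma sum_index_times_convolution:
  fixes f :: "nat \<Rightarrow> 'a :: comm_ring_1"
  shows "2 * (\<Sum>i\<le>n. of_nat i * (f i * f (n - i))) = of_nat n * (\<Sum>i\<le>n. f i * f (n - i))"
proof -
  have "(\<Sum>i\<le>n. of_nat i * (f i * f (n - i))) = (\<Sum>i\<le>n. of_nat (n - i) * (f i * f (n - i)))"
    by (rule sum.reindex_bij_witness[where i = "\<lambda>i. n - i" and j = "\<lambda>i. n - i"])
       (auto simp: mult_ac)
  then have "2 * (\<Sum>i\<le>n. of_nat i * (f i * f (n - i)))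
      = (\<Sum>i\<le>n. of_nat i * (f i * f (n - i)) + of_nat (n - i) * (f i * f (n - i)))"
    by (simp only: mult_2 sum.distrib)
  also have "\<dots> = (\<Sum>i\<le>n. of_nat n * (f i * f (n - i)))"
    by (intro sum.cong) (simp_all flip: distrib_right of_nat_add)
  finally show ?thesis by (simp only: sum_distrib_left)
qed

theorem catalan_convolution: "(\<Sum>i\<le>n. catalan i * catalan (n - i)) = catalan (Suc n)"
proof (induction n)
  case 0
  then show ?case using catalan_Suc[of 0] by (simp add: catalan_0)
next
  case (Suc n)
  define conv where "conv n = (\<Sum>i\<le>n. catalan i * catalan (n - i))" for n
  have weighted: "2 * (\<Sum>i\<le>n. (real i + 1) * (catalan i * catalan (n - i))) = (real n + 2) * conv n"
    for n
    using sum_index_times_convolution[of catalan n]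
    by (simp add: conv_def sum.distrib algebra_simps)
  have "(\<Sum>i\<le>Suc n. (real i + 1) * (catalan i * catalan (Suc n - i)))
      = catalan (Suc n) + (\<Sum>i\<le>n. (real i + 2) * catalan (Suc i) * catalan (n - i))"
    by (subst sum.atMost_Suc_shift) (simp add: catalan_0 algebra_simps)
  also have "(\<Sum>i\<le>n. (real i + 2) * catalan (Suc i) * catalan (n - i))
      = (\<Sum>i\<le>n. 4 * (real i * (catalan i * catalan (n - i))) + 2 * (catalan i * catalan (n - i)))"
    by (simp only: catalan_Suc) (simp add: algebra_simps)
  also have "\<dots> = 2 * (real n * conv n) + 2 * conv n"
    using sum_index_times_convolution[of catalan n]
    by (simp add: conv_def sum.distrib flip: sum_distrib_left)
  finally have "(real n + 3) * conv (Suc n) = 2 * catalan (Suc n) + 4 * (real n + 1) * conv n"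
    using weighted[of "Suc n"] by (simp add: algebra_simps)
  also have "\<dots> = (4 * real (Suc n) + 2) * catalan (Suc n)"
    using Suc by (simp add: conv_def algebra_simps)
  also have "\<dots> = (real n + 3) * catalan (Suc (Suc n))"
    using catalan_Suc[of "Suc n"] by (simp add: algebra_simps)
  finally have "conv (Suc n) = catalan (Suc (Suc n))"
    by simp
  then show ?case by (simp only: conv_def)
qed

section \<open>Sequences of column heights\<close>

text \<open>The top cell of a column of height \<open>k\<close> lies \<open>k + 1 - h\<close> rows above the top cell of a preceding
  column of height \<open>h\<close>. Subtraction on \<^typ>\<open>nat\<close> discards the descents.\<close>

fun ascent :: "nat \<Rightarrow> nat list \<Rightarrow> nat" where
  "ascent h [] = 0"
| "ascent h (k # hs) = (k + 1 - h) + ascent k hs"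

text \<open>Starting from height 2 rather than 1 lowers the ascent of a nonempty list by one, so that
  \<open>N\<close> is the vertical semiperimeter minus one. The shift is needed for the empty list to act as a
  possible left or right part in the decomposition \<open>ascent_map_Suc_append_2\<close>.\<close>

definition tall_lists :: "nat \<Rightarrow> nat \<Rightarrow> nat list set" where
  "tall_lists m N = {hs. length hs = m \<and> (\<forall>h\<in>set hs. 2 \<le> h) \<and> ascent 2 hs = N}"

lemma ascent_append: "ascent h (gs @ ks) = ascent h gs + ascent (last (h # gs)) ks"
  by (induction gs arbitrary: h) auto

lemma ascent_Suc_map_Suc: "ascent (Suc h) (map Suc hs) = ascent h hs"
  by (induction hs arbitrary: h) auto

lemma ascent_map_Suc:
  "hs \<noteq> [] \<Longrightarrow> h \<le> Suc (hd hs) \<Longrightarrow> ascent h (map Suc hs) = Suc (ascent h hs)"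
  by (cases hs) (auto simp: ascent_Suc_map_Suc)

lemma ascent_1_eq_Suc_ascent_2:
  assumes "hs \<noteq> []" "\<forall>h\<in>set hs. 2 \<le> h"
  shows "ascent 1 hs = Suc (ascent 2 hs)"
  using assms by (cases hs) auto

lemma ascent_map_Suc_append_2:
  assumes "\<forall>g\<in>set gs. 2 \<le> g"
  shows "ascent 2 (map Suc gs @ 2 # ks) = Suc (ascent 2 gs + ascent 2 ks)"
proof (cases "gs = []")
  case False
  then have "2 \<le> hd gs" "2 \<le> last gs" using assms by simp_all
  then show ?thesis
    using False ascent_map_Suc[of gs 2] by (simp add: ascent_append last_map)
qed simp

lemma ascent_conv_sum: "ascent h hs = (\<Sum>i<length hs. hs ! i + 1 - (h # hs) ! i)"
  by (induction hs arbitrary: h) (simp_all add: sum.lessThan_Suc_shift del: sum.lessThan_Suc)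

lemma le_add_ascent: "k \<in> set hs \<Longrightarrow> k \<le> h + ascent h hs"
proof (induction hs arbitrary: h)
  case (Cons j hs)
  then have "k \<le> j + ascent j hs" by auto
  then show ?case by simp
qed simp

lemma finite_tall_lists: "finite (tall_lists m N)"
proof (rule finite_subset)
  show "tall_lists m N \<subseteq> {hs. set hs \<subseteq> {..2 + N} \<and> length hs = m}"
    using le_add_ascent[of _ _ 2] by (auto simp: tall_lists_def)
qed (rule finite_lists_length_eq, simp)

lemma tall_lists_0: "tall_lists 0 N = (if N = 0 then {[]} else {})"
  by (auto simp: tall_lists_def)

lemma tall_lists_Suc_0: "tall_lists (Suc m) 0 = {}"
  by (auto simp: tall_lists_def length_Suc_conv)

lemma obtain_map_Suc:
  assumes "\<forall>h\<in>set hs. k \<le> h" "k \<notin> set hs"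
  obtains gs where "hs = map Suc gs" "\<forall>g\<in>set gs. k \<le> g"
proof
  have less: "k < h" if "h \<in> set hs" for h
    using assms that by (metis le_neq_implies_less)
  then have "Suc (h - 1) = h" if "h \<in> set hs" for h
    using that by fastforce
  then show "hs = map Suc (map (\<lambda>h. h - 1) hs)"
    unfolding map_map by (intro map_idI[symmetric]) simp
  show "\<forall>g\<in>set (map (\<lambda>h. h - 1) hs). k \<le> g"
    by (auto dest!: less)
qed

lemma map_Suc_mem_tall_lists_iff:
  assumes "\<forall>g\<in>set gs. 2 \<le> g"
  shows "map Suc gs \<in> tall_lists (Suc m) (Suc N) \<longleftrightarrow> gs \<in> tall_lists (Suc m) N"
  using assms ascent_map_Suc[of gs 2] by (cases gs) (auto simp: tall_lists_def)

lemma map_Suc_append_2_mem_tall_lists_iff: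
  assumes "\<forall>g\<in>set gs. 2 \<le> g"
  shows "map Suc gs @ 2 # ks \<in> tall_lists (Suc m) (Suc N)
    \<longleftrightarrow> (\<exists>i\<le>m. \<exists>a\<le>N. gs \<in> tall_lists i a \<and> ks \<in> tall_lists (m - i) (N - a))"
  using assms ascent_map_Suc_append_2[OF assms, of ks] by (auto simp: tall_lists_def)

lemma tall_lists_without_2:
  "{hs \<in> tall_lists (Suc m) (Suc N). 2 \<notin> set hs} = map Suc ` tall_lists (Suc m) N"
proof (intro equalityI subsetI)
  fix hs assume hs: "hs \<in> {hs \<in> tall_lists (Suc m) (Suc N). 2 \<notin> set hs}"
  then obtain gs where "hs = map Suc gs" "\<forall>g\<in>set gs. 2 \<le> g"
    by (auto simp: tall_lists_def intro: obtain_map_Suc[of hs 2])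
  then show "hs \<in> map Suc ` tall_lists (Suc m) N"
    using hs map_Suc_mem_tall_lists_iff[of gs] by blast
next
  fix hs assume "hs \<in> map Suc ` tall_lists (Suc m) N"
  then obtain gs where gs: "gs \<in> tall_lists (Suc m) N" "hs = map Suc gs" by blast
  then have "\<forall>g\<in>set gs. 2 \<le> g" by (simp add: tall_lists_def)
  then show "hs \<in> {hs \<in> tall_lists (Suc m) (Suc N). 2 \<notin> set hs}"
    using gs map_Suc_mem_tall_lists_iff[of gs] by auto
qed

lemma append_Cons_first_inject:
  assumes "xs @ x # ys = xs' @ x # ys'" "x \<notin> set xs" "x \<notin> set xs'"
  shows "xs = xs' \<and> ys = ys'"
  using assms by (auto simp: append_eq_append_conv2 append_eq_Cons_conv Cons_eq_append_conv)

lemma bij_betw_tall_lists_with_2: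
  "bij_betw (\<lambda>(i, a, gs, ks). map Suc gs @ 2 # ks)
     (SIGMA i:{..m}. SIGMA a:{..N}. tall_lists i a \<times> tall_lists (m - i) (N - a))
     {hs \<in> tall_lists (Suc m) (Suc N). 2 \<in> set hs}"
  (is "bij_betw ?join ?S ?T")
proof (rule bij_betw_imageI)
  have tall: "\<forall>g\<in>set gs. 2 \<le> g" if "gs \<in> tall_lists i a" for gs i a
    using that by (simp add: tall_lists_def)
  then have no_2: "2 \<notin> set (map Suc gs)" if "gs \<in> tall_lists i a" for gs i a
    using that by fastforce
  show "inj_on ?join ?S"
  proof (rule inj_onI, clarify)
    fix i a gs ks i' a' gs' ks'
    assume "gs \<in> tall_lists i a" "gs' \<in> tall_lists i' a'"
      and "map Suc gs @ 2 # ks = map Suc gs' @ 2 # ks'"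
    then have "gs = gs' \<and> ks = ks'"
      using no_2 by (metis append_Cons_first_inject inj_Suc inj_map_eq_map)
    then show "i = i' \<and> (a, gs, ks) = (a', gs', ks')"
      using \<open>gs \<in> _\<close> \<open>gs' \<in> _\<close> by (simp add: tall_lists_def)
  qed
  show "?join ` ?S = ?T"
  proof (intro equalityI subsetI)
    fix hs assume "hs \<in> ?join ` ?S"
    then obtain i a gs ks where hs: "hs = map Suc gs @ 2 # ks" "i \<le> m" "a \<le> N"
        "gs \<in> tall_lists i a" "ks \<in> tall_lists (m - i) (N - a)"
      by auto
    then show "hs \<in> ?T"
      using map_Suc_append_2_mem_tall_lists_iff[OF tall[OF hs(4)], of ks m N] by auto
  next
    fix hs assume hs: "hs \<in> ?T"
    then obtain us ks where split: "hs = us @ 2 # ks" "2 \<notin> set us"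
      by (auto dest: split_list_first)
    moreover have "\<forall>u\<in>set us. 2 \<le> u" using hs split by (simp add: tall_lists_def)
    ultimately obtain gs where us: "us = map Suc gs" and "\<forall>g\<in>set gs. 2 \<le> g"
      using obtain_map_Suc[of us 2] by blast
    then obtain i a where "(i, a, gs, ks) \<in> ?S"
      using hs split map_Suc_append_2_mem_tall_lists_iff[of gs ks m N] by auto
    then show "hs \<in> ?join ` ?S"
      by (rule rev_image_eqI) (simp add: split us)
  qed
qed

lemma card_tall_lists_Suc:
  "card (tall_lists (Suc m) (Suc N)) = card (tall_lists (Suc m) N)
     + (\<Sum>i\<le>m. \<Sum>a\<le>N. card (tall_lists i a) * card (tall_lists (m - i) (N - a)))"
proof -
  let ?without = "{hs \<in> tall_lists (Suc m) (Suc N). 2 \<notin> set hs}"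
  let ?with = "{hs \<in> tall_lists (Suc m) (Suc N). 2 \<in> set hs}"
  have "tall_lists (Suc m) (Suc N) = ?without \<union> ?with" by auto
  also have "card (?without \<union> ?with) = card ?without + card ?with"
    by (rule card_Un_disjoint) (auto simp: finite_tall_lists)
  finally have "card (tall_lists (Suc m) (Suc N)) = card ?without + card ?with" .
  moreover have "card ?without = card (tall_lists (Suc m) N)"
    unfolding tall_lists_without_2 by (simp add: card_image inj_on_def)
  moreover have "card ?with
      = (\<Sum>i\<le>m. \<Sum>a\<le>N. card (tall_lists i a) * card (tall_lists (m - i) (N - a)))"
    by (simp flip: bij_betw_same_card[OF bij_betw_tall_lists_with_2]
        add: card_SigmaI card_cartesian_product finite_tall_lists)
  ultimately show ?thesis by simp
qed

definition tall_lists_gf :: "nat \<Rightarrow> real fps" where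
  "tall_lists_gf m = Abs_fps (\<lambda>N. real (card (tall_lists m N)))"

lemma tall_lists_gf_Suc:
  "(1 - fps_X) * tall_lists_gf (Suc m) = fps_X * (\<Sum>i\<le>m. tall_lists_gf i * tall_lists_gf (m - i))"
proof (rule fps_ext)
  fix N
  show "fps_nth ((1 - fps_X) * tall_lists_gf (Suc m)) N
      = fps_nth (fps_X * (\<Sum>i\<le>m. tall_lists_gf i * tall_lists_gf (m - i))) N"
  proof (cases N)
    case 0
    then show ?thesis by (simp add: tall_lists_gf_def tall_lists_Suc_0)
  next
    case (Suc N')
    then show ?thesis
      by (simp add: tall_lists_gf_def card_tall_lists_Suc left_diff_distrib fps_sum_nth)
         (simp add: fps_mult_nth atLeast0AtMost)
  qed
qed

lemma power_mult_eq_mult_power_add: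
  fixes u x :: "'a :: comm_semiring_1"
  assumes "u ^ i * a = c * x ^ i" "u ^ j * b = d * x ^ j"
  shows "u ^ (i + j) * (a * b) = c * d * x ^ (i + j)"
proof -
  have "u ^ (i + j) * (a * b) = (u ^ i * a) * (u ^ j * b)"
    by (simp add: power_add mult_ac)
  also have "\<dots> = c * d * x ^ (i + j)"
    unfolding assms by (simp add: power_add mult_ac)
  finally show ?thesis .
qed

theorem tall_lists_gf_eq:
  "(1 - fps_X) ^ m * tall_lists_gf m = fps_const (catalan m) * fps_X ^ m"
proof (induction m rule: less_induct)
  case (less m)
  show ?case
  proof (cases m)
    case 0
    have "tall_lists_gf 0 = 1"
      by (rule fps_ext) (simp add: tall_lists_gf_def tall_lists_0)
    then show ?thesis by (simp add: 0 catalan_0)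
  next
    case (Suc k)
    have "(1 - fps_X) ^ k * (tall_lists_gf i * tall_lists_gf (k - i))
        = fps_const (catalan i * catalan (k - i)) * fps_X ^ k" if "i \<le> k" for i
      using that Suc power_mult_eq_mult_power_add[OF less[of i] less[of "k - i"]] by simp
    then have "(1 - fps_X) ^ k * (\<Sum>i\<le>k. tall_lists_gf i * tall_lists_gf (k - i))
        = (\<Sum>i\<le>k. fps_const (catalan i * catalan (k - i))) * fps_X ^ k"
      by (simp add: sum_distrib_left sum_distrib_right)
    also have "(\<Sum>i\<le>k. fps_const (catalan i * catalan (k - i))) = fps_const (catalan m)"
      unfolding Suc by (rule fps_ext) (simp add: fps_sum_nth flip: catalan_convolution)
    finally have "(1 - fps_X) ^ k * (\<Sum>i\<le>k. tall_lists_gf i * tall_lists_gf (k - i))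
        = fps_const (catalan m) * fps_X ^ k" .
    then have "(1 - fps_X) ^ k * ((1 - fps_X) * tall_lists_gf (Suc k))
        = fps_const (catalan m) * (fps_X * fps_X ^ k)"
      unfolding tall_lists_gf_Suc by (simp add: mult_ac)
    then show ?thesis by (simp add: Suc mult_ac)
  qed
qed

lemma fps_nth_inverse_one_minus_fps_X_power:
  "fps_nth (inverse ((1 - fps_X) ^ Suc k)) j = (of_nat ((k + j) choose k) :: 'a :: field_char_0)"
  using one_minus_const_fps_X_neg_power'[of "Suc k" "1 :: 'a"] binomial_symmetric[of k "k + j"]
  by (simp del: power_Suc)

corollary card_tall_lists:
  assumes "1 \<le> N"
  shows "real (card (tall_lists m N)) = catalan m * real (binom (N - 1) (int m - 1))"
proof (cases m)
  case 0
  then show ?thesis using assms by (simp add: tall_lists_0 binom_def)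
next
  case (Suc k)
  have "fps_const (catalan m) * fps_X ^ m * inverse ((1 - fps_X) ^ m)
      = tall_lists_gf m * ((1 - fps_X) ^ m * inverse ((1 - fps_X) ^ m))"
    by (simp only: tall_lists_gf_eq[symmetric] mult_ac)
  also have "\<dots> = tall_lists_gf m"
    by (simp add: inverse_mult_eq_1' fps_power_zeroth)
  finally have "real (card (tall_lists m N))
      = fps_nth (fps_const (catalan m) * fps_X ^ m * inverse ((1 - fps_X) ^ m)) N"
    by (simp add: tall_lists_gf_def)
  also have "\<dots> = catalan m * (if N < m then 0 else real ((k + (N - m)) choose k))"
    by (simp add: Suc mult.assoc fps_X_power_mult_nth fps_nth_inverse_one_minus_fps_X_power
        del: power_Suc)
  also have "(if N < m then 0 else real ((k + (N - m)) choose k))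
      = real (binom (N - 1) (int m - 1))"
    using assms Suc by (auto simp: binom_def)
  finally show ?thesis .
qed

section \<open>Translations and semiperimeters\<close>

lemma mem_translate: "(x, y) \<in> translate v P \<longleftrightarrow> (x - fst v, y - snd v) \<in> P"
  by (force simp: translate_def)

lemma card_translate: "card (translate v P) = card P"
  unfolding translate_def by (rule card_image) (auto simp: inj_on_def)

lemma fst_translate: "fst ` translate v P = (+) (fst v) ` fst ` P"
  by (force simp: translate_def image_image)

lemma column_translate: "column (translate v P) x = (+) (snd v) ` column P (x - fst v)"
  by (force simp: column_def mem_translate image_iff)

lemma Min_plus_image_int:
  fixes a :: int
  assumes "finite A" "A \<noteq> {}"
  shows "Min ((+) a ` A) = a + Min A"
  using assms by (intro mono_Min_commute[symmetric]) (auto simp: mono_def)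

lemma boundary_eq_sym_diff_translate:
  fixes edges :: "cell \<Rightarrow> (int \<times> int) set"
  assumes "d \<noteq> (0, 0)"
    and edges: "\<And>c x y. (x, y) \<in> edges c \<longleftrightarrow> c = (x, y) \<or> c = (x - fst d, y - snd d)"
  shows "{e. \<exists>!c. c \<in> P \<and> e \<in> edges c} = sym_diff P (translate d P)"
proof -
  have unique_iff: "(\<exists>!c. c \<in> P \<and> (c = a \<or> c = b)) \<longleftrightarrow> (a \<in> P) \<noteq> (b \<in> P)" if "a \<noteq> b" for a b
    using that by metis
  have "(\<exists>!c. c \<in> P \<and> (x, y) \<in> edges c) \<longleftrightarrow> ((x, y) \<in> P) \<noteq> ((x, y) \<in> translate d P)" for x y
    unfolding edges mem_translate using assms(1) by (intro unique_iff) (auto simp: prod_eq_iff)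
  then show ?thesis by (auto simp only: set_eq_iff split_paired_All mem_Collect_eq Un_iff Diff_iff)
qed

lemma horizontal_semiperimeter_conv_translate:
  "horizontal_semiperimeter P = real (card (sym_diff P (translate (0, 1) P))) / 2"
  unfolding horizontal_semiperimeter_def
  by (subst boundary_eq_sym_diff_translate[of "(0, 1)"]) (auto simp: horizontal_edges_def)

lemma vertical_semiperimeter_conv_translate:
  "vertical_semiperimeter P = real (card (sym_diff P (translate (1, 0) P))) / 2"
  unfolding vertical_semiperimeter_def
  by (subst boundary_eq_sym_diff_translate[of "(1, 0)"]) (auto simp: vertical_edges_def)

lemma sym_diff_translate_translate:
  "sym_diff (translate v P) (translate d (translate v P))
    = translate v (sym_diff P (translate d P))"
  by (auto simp: mem_translate algebra_simps)

lemma horizontal_semiperimeter_translate: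
  "horizontal_semiperimeter (translate v P) = horizontal_semiperimeter P"
  by (simp only: horizontal_semiperimeter_conv_translate sym_diff_translate_translate
      card_translate)

lemma vertical_semiperimeter_translate:
  "vertical_semiperimeter (translate v P) = vertical_semiperimeter P"
  by (simp only: vertical_semiperimeter_conv_translate sym_diff_translate_translate
      card_translate)

lemma card_sym_diff_translate:
  assumes "finite P"
  shows "card (sym_diff P (translate d P)) = 2 * card (P - translate d P)"
proof -
  have fin: "finite (translate d P)" using assms by (simp add: translate_def)
  have "card (P - translate d P) = card (translate d P - P)"
    by (intro antisym card_le_sym_Diff) (simp_all add: assms fin card_translate)
  then show ?thesis
    using assms fin by (subst card_Un_disjoint) auto
qed

corollary horizontal_semiperimeter_eq_card:
  "finite P \<Longrightarrow> horizontal_semiperimeter P = real (card (P - translate (0, 1) P))"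
  by (simp add: horizontal_semiperimeter_conv_translate card_sym_diff_translate)

corollary vertical_semiperimeter_eq_card:
  "finite P \<Longrightarrow> vertical_semiperimeter P = real (card (P - translate (1, 0) P))"
  by (simp add: vertical_semiperimeter_conv_translate card_sym_diff_translate)

section \<open>Staircases\<close>

definition fibonacci_heights :: "nat list \<Rightarrow> bool" where
  "fibonacci_heights hs \<longleftrightarrow> hs \<noteq> [] \<and> (\<forall>h\<in>set (butlast hs). 2 \<le> h) \<and> 1 \<le> last hs"

definition staircase :: "nat list \<Rightarrow> cell set" where
  "staircase hs = (SIGMA x:{0..<int (length hs)}. {x..<x + int (hs ! nat x)})"

lemma fibonacci_heights_ge_1: "fibonacci_heights hs \<Longrightarrow> h \<in> set hs \<Longrightarrow> 1 \<le> h"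
  by (cases hs rule: rev_cases) (auto simp: fibonacci_heights_def)

lemma fibonacci_heights_nth_ge_2:
  assumes "fibonacci_heights hs" "Suc i < length hs"
  shows "2 \<le> hs ! i"
proof -
  have "butlast hs ! i \<in> set (butlast hs)" using assms(2) by (intro nth_mem) simp
  then show ?thesis using assms by (simp add: fibonacci_heights_def nth_butlast)
qed

lemma finite_staircase: "finite (staircase hs)"
  by (simp add: staircase_def)

lemma column_staircase:
  "column (staircase hs) x = (if x \<in> {0..<int (length hs)} then {x..<x + int (hs ! nat x)} else {})"
  by (auto simp: column_def staircase_def)

lemma fst_staircase:
  assumes "fibonacci_heights hs"
  shows "fst ` staircase hs = {0..<int (length hs)}"
proof
  show "{0..<int (length hs)} \<subseteq> fst ` staircase hs"
  proof
    fix x assume x: "x \<in> {0..<int (length hs)}"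
    then have "1 \<le> hs ! nat x" by (intro fibonacci_heights_ge_1[OF assms] nth_mem) auto
    then have "(x, x) \<in> staircase hs" using x by (auto simp: staircase_def)
    then show "x \<in> fst ` staircase hs" by force
  qed
qed (auto simp: staircase_def)

lemma staircase_nonempty: "fibonacci_heights hs \<Longrightarrow> staircase hs \<noteq> {}"
  using fst_staircase[of hs] by (auto simp: fibonacci_heights_def)

lemma last_column_height_staircase:
  assumes "fibonacci_heights hs"
  shows "last_column_height (staircase hs) = last hs"
proof -
  have "hs \<noteq> []" using assms by (simp add: fibonacci_heights_def)
  then have "Max (fst ` staircase hs) = int (length hs - 1)"
    unfolding fst_staircase[OF assms] by (intro Max_eqI) (auto simp: Suc_le_eq)
  then show ?thesis
    using \<open>hs \<noteq> []\<close> by (simp add: last_column_height_def column_staircase last_conv_nth)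
qed

lemma horizontal_semiperimeter_staircase:
  assumes "fibonacci_heights hs"
  shows "horizontal_semiperimeter (staircase hs) = real (length hs)"
proof -
  let ?I = "{0..<int (length hs)}"
  have "1 \<le> hs ! nat x" if "x \<in> ?I" for x
    using that by (intro fibonacci_heights_ge_1[OF assms] nth_mem) auto
  then have "staircase hs - translate (0, 1) (staircase hs) = (\<lambda>x. (x, x)) ` ?I"
    by (fastforce simp: staircase_def mem_translate)
  then show ?thesis
    by (simp add: horizontal_semiperimeter_eq_card finite_staircase card_image inj_on_def)
qed

lemma vertical_semiperimeter_staircase:
  assumes "\<forall>h\<in>set hs. 1 \<le> h"
  shows "vertical_semiperimeter (staircase hs) = real (ascent 1 hs)"
proof -
  let ?I = "{0..<int (length hs)}"
  let ?new_cells = "\<lambda>x. {x - 1 + int ((1 # hs) ! nat x)..<x + int (hs ! nat x)}"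
  have "(x, y) \<in> staircase hs - translate (1, 0) (staircase hs)
      \<longleftrightarrow> x \<in> ?I \<and> y \<in> ?new_cells x" for x y
  proof (cases "x \<in> ?I \<and> 0 < x")
    case True
    then obtain i where i: "x = int (Suc i)" "Suc i < length hs"
      by (metis atLeastLessThan_iff gr0_implies_Suc of_nat_less_iff of_nat_0_less_iff pos_int_cases)
    then have "1 \<le> hs ! i" using assms by simp
    then show ?thesis using i by (auto simp: staircase_def mem_translate nat_add_distrib)
  qed (auto simp: staircase_def mem_translate)
  then have "staircase hs - translate (1, 0) (staircase hs) = (SIGMA x:?I. ?new_cells x)"
    by (auto simp only: set_eq_iff split_paired_All mem_Sigma_iff)
  then have "card (staircase hs - translate (1, 0) (staircase hs)) = (\<Sum>x\<in>?I. card (?new_cells x))"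
    by (simp add: card_SigmaI)
  also have "\<dots> = (\<Sum>i<length hs. hs ! i + 1 - (1 # hs) ! i)"
    by (rule sum.reindex_bij_witness[where i = int and j = nat]) auto
  finally show ?thesis
    by (simp add: vertical_semiperimeter_eq_card finite_staircase ascent_conv_sum)
qed

abbreviation cell_graph :: "cell set \<Rightarrow> (cell \<times> cell) set" where
  "cell_graph P \<equiv> {(a, b). a \<in> P \<and> b \<in> P \<and> adjacent a b}"

lemma cell_graph_rtrancl_sym: "(c, d) \<in> (cell_graph P)\<^sup>* \<Longrightarrow> (d, c) \<in> (cell_graph P)\<^sup>*"
  by (rule symD[OF sym_rtrancl]) (auto simp: sym_def adjacent_def)

lemma vertical_segment_connected:
  assumes "y \<le> y'" "{x} \<times> {y..y'} \<subseteq> P"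
  shows "((x, y), (x, y')) \<in> (cell_graph P)\<^sup>*"
  using assms
proof (induction y' rule: int_ge_induct)
  case (step y')
  have "((x, y'), (x, y' + 1)) \<in> cell_graph P"
    using step by (auto simp: adjacent_def)
  moreover have "((x, y), (x, y')) \<in> (cell_graph P)\<^sup>*"
    using step.prems by (intro step.IH) auto
  ultimately show ?case by (rule rtrancl_into_rtrancl[rotated])
qed simp

lemma staircase_diagonal_connected:
  assumes "fibonacci_heights hs"
  shows "i < length hs \<Longrightarrow> ((0, 0), (int i, int i)) \<in> (cell_graph (staircase hs))\<^sup>*"
proof (induction i)
  case (Suc i)
  have "2 \<le> hs ! i" by (rule fibonacci_heights_nth_ge_2[OF assms Suc.prems])
  moreover have "1 \<le> hs ! Suc i" using Suc.prems by (intro fibonacci_heights_ge_1[OF assms] nth_mem)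
  ultimately have "((int i, int i), (int i, int i + 1)) \<in> cell_graph (staircase hs)"
    and "((int i, int i + 1), (int (Suc i), int (Suc i))) \<in> cell_graph (staircase hs)"
    using Suc.prems by (auto simp: staircase_def adjacent_def nat_add_distrib)
  moreover have "((0, 0), (int i, int i)) \<in> (cell_graph (staircase hs))\<^sup>*"
    using Suc by simp
  ultimately show ?case by (meson rtrancl_into_rtrancl)
qed simp

lemma polyomino_staircase:
  assumes "fibonacci_heights hs"
  shows "polyomino (staircase hs)"
proof -
  have reachable: "((0, 0), c) \<in> (cell_graph (staircase hs))\<^sup>*" if "c \<in> staircase hs" for c
  proof -
    obtain x y where c: "c = (x, y)" by fastforce
    then have xy: "0 \<le> x" "nat x < length hs" "x \<le> y" "y < x + int (hs ! nat x)"
      using that by (auto simp: staircase_def nat_less_iff)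
    then have "((x, x), (x, y)) \<in> (cell_graph (staircase hs))\<^sup>*"
      by (intro vertical_segment_connected) (auto simp: staircase_def)
    then show ?thesis
      using staircase_diagonal_connected[OF assms xy(2)] xy(1) c by simp
  qed
  have "(c, d) \<in> (cell_graph (staircase hs))\<^sup>*" if "c \<in> staircase hs" "d \<in> staircase hs" for c d
    using cell_graph_rtrancl_sym[OF reachable[OF that(1)]] reachable[OF that(2)]
    by (rule rtrancl_trans)
  then show ?thesis
    using assms by (simp add: polyomino_def finite_staircase staircase_nonempty)
qed

lemma Min_atLeastLessThan_int: "a < b \<Longrightarrow> Min {a..<b} = (a :: int)"
  by (intro Min_eqI) auto

lemma fibonacci_polyomino_staircase:
  assumes "fibonacci_heights hs"
  shows "fibonacci_polyomino (staircase hs)"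
proof -
  have "\<exists>a b. column (staircase hs) x = {a..b}" for x
  proof (cases "x \<in> {0..<int (length hs)}")
    case True
    then have "column (staircase hs) x = {x..x + int (hs ! nat x) - 1}"
      by (auto simp: column_staircase)
    then show ?thesis by blast
  next
    case False
    then have "column (staircase hs) x = {1..0}" by (simp only: column_staircase) simp
    then show ?thesis by blast
  qed
  moreover have "Min (column (staircase hs) x) = x" if "column (staircase hs) x \<noteq> {}" for x
    using that by (auto simp: column_staircase Min_atLeastLessThan_int split: if_splits)
  ultimately show ?thesis
    using polyomino_staircase[OF assms]
    by (auto simp: fibonacci_polyomino_def column_convex_def)
qed

section \<open>Column heights of a Fibonacci polyomino\<close>

definition column_heights :: "cell set \<Rightarrow> nat list" where
  "column_heights P = map (\<lambda>i. card (column P (Min (fst ` P) + int i))) [0..<card (fst ` P)]"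

lemma column_heights_staircase:
  assumes "fibonacci_heights hs"
  shows "column_heights (staircase hs) = hs"
proof -
  have "hs \<noteq> []" using assms by (simp add: fibonacci_heights_def)
  then have "Min (fst ` staircase hs) = 0"
    by (simp add: fst_staircase[OF assms] Min_atLeastLessThan_int)
  then show ?thesis
    by (intro nth_equalityI)
       (auto simp: column_heights_def fst_staircase[OF assms] column_staircase)
qed

lemma column_heights_translate:
  assumes "finite P" "P \<noteq> {}"
  shows "column_heights (translate v P) = column_heights P"
  using assms
  by (simp add: column_heights_def fst_translate column_translate card_image Min_plus_image_int)

lemma last_column_height_translate:
  assumes "finite P" "P \<noteq> {}"
  shows "last_column_height (translate v P) = last_column_height P"
proof -
  have "Max (fst ` translate v P) = fst v + Max (fst ` P)"
    unfolding fst_translate using assms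
    by (intro mono_Max_commute[symmetric]) (auto simp: mono_def)
  then show ?thesis
    by (simp add: last_column_height_def column_translate card_image)
qed

lemma polyomino_crossing:
  assumes "polyomino P" and c: "c \<in> P" "fst c \<le> x" and d: "d \<in> P" "x < fst d"
  obtains y where "(x, y) \<in> P" "(x + 1, y) \<in> P"
proof -
  have "(c, d) \<in> (cell_graph P)\<^sup>*"
    using assms by (simp add: polyomino_def)
  then have "fst d \<le> x \<or> (\<exists>y. (x, y) \<in> P \<and> (x + 1, y) \<in> P)"
  proof (induction rule: rtrancl_induct)
    case base
    then show ?case using c by simp
  next
    case (step a b)
    show ?case
    proof (cases "fst a \<le> x \<and> x < fst b")
      case True
      then have "a = (x, snd a)" "b = (x + 1, snd a)" "a \<in> P" "b \<in> P"
        using step(2) by (auto simp: adjacent_def prod_eq_iff)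
      then show ?thesis by metis
    qed (use step(3) in auto)
  qed
  then show thesis using d that by auto
qed

lemma polyomino_fst_image:
  assumes "polyomino P"
  shows "fst ` P = {Min (fst ` P)..<Min (fst ` P) + int (card (fst ` P))}"
proof -
  let ?X = "fst ` P"
  have X: "finite ?X" "?X \<noteq> {}" using assms by (auto simp: polyomino_def)
  have "{Min ?X..Max ?X} \<subseteq> ?X"
  proof
    fix x assume x: "x \<in> {Min ?X..Max ?X}"
    obtain c d where cd: "c \<in> P" "fst c = Min ?X" "d \<in> P" "fst d = Max ?X"
      using Min_in[OF X] Max_in[OF X] by force
    show "x \<in> ?X"
    proof (cases "x = Max ?X")
      case False
      then obtain y where "(x, y) \<in> P"
        using polyomino_crossing[OF assms, of c x d] cd x by auto
      then show ?thesis by force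
    qed (use Max_in[OF X] in simp)
  qed
  then have interval: "?X = {Min ?X..Max ?X}"
    using X by (meson Max_ge Min_le atLeastAtMost_iff subsetI subset_antisym)
  have "card ?X = nat (Max ?X - Min ?X + 1)"
    by (subst interval) simp
  moreover have "Min ?X \<le> Max ?X" using X by simp
  ultimately have "Min ?X + int (card ?X) = Max ?X + 1" by simp
  then show ?thesis using interval by (simp only: atLeastLessThanPlusOne_atLeastAtMost_int)
qed

context
  fixes P :: "cell set" and left bottom :: int
  assumes fibonacci: "fibonacci_polyomino P"
  defines "left \<equiv> Min (fst ` P)" and "bottom \<equiv> Min (column P left)"
begin

lemma fibonacci_polyomino_imp_polyomino: "polyomino P"
  using fibonacci by (simp add: fibonacci_polyomino_def)

lemma column_nonempty_iff: "column P x \<noteq> {} \<longleftrightarrow> x \<in> {left..<left + int (length (column_heights P))}"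
proof -
  have "column P x \<noteq> {} \<longleftrightarrow> x \<in> fst ` P" by (force simp: column_def)
  also have "\<dots> \<longleftrightarrow> x \<in> {left..<left + int (length (column_heights P))}"
    by (subst polyomino_fst_image[OF fibonacci_polyomino_imp_polyomino])
       (simp add: left_def column_heights_def)
  finally show ?thesis .
qed

lemma Min_column_fibonacci_polyomino:
  "i < length (column_heights P) \<Longrightarrow> Min (column P (left + int i)) = bottom + int i"
proof (induction i)
  case (Suc i)
  then have "column P (left + int i) \<noteq> {}" "column P (left + int i + 1) \<noteq> {}"
    by (simp_all add: column_nonempty_iff)
  then have "Min (column P (left + int i + 1)) = Min (column P (left + int i)) + 1"
    using fibonacci by (simp add: fibonacci_polyomino_def)
  then show ?case using Suc by (simp add: add.assoc add.commute[of 1])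
qed (simp add: bottom_def)

lemma column_fibonacci_polyomino:
  assumes "i < length (column_heights P)"
  shows "column P (left + int i) = {bottom + int i..<bottom + int i + int (column_heights P ! i)}"
proof -
  obtain l u where column: "column P (left + int i) = {l..u}"
    using fibonacci unfolding fibonacci_polyomino_def column_convex_def by blast
  have "l \<le> u" using column_nonempty_iff[of "left + int i"] column assms by auto
  then have "l = bottom + int i"
    using Min_column_fibonacci_polyomino[OF assms] column Min_eqI[of "{l..u}" l] by simp
  moreover have "column_heights P ! i = nat (u - l + 1)"
    using assms column by (simp add: column_heights_def left_def)
  moreover have "{l..u} = {l..<l + int (nat (u - l + 1))}" using \<open>l \<le> u\<close> by auto
  ultimately show ?thesis using column by simp
qed

lemma fibonacci_heights_column_heights: "fibonacci_heights (column_heights P)"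
proof -
  let ?hs = "column_heights P"
  have "P \<noteq> {}" "finite P" using fibonacci_polyomino_imp_polyomino by (simp_all add: polyomino_def)
  then have nonempty: "?hs \<noteq> []" by (simp add: column_heights_def)
  have "1 \<le> ?hs ! i" if "i < length ?hs" for i
    using column_fibonacci_polyomino[OF that] column_nonempty_iff[of "left + int i"] that by auto
  then have "1 \<le> last ?hs" using nonempty by (simp add: last_conv_nth)
  moreover have "2 \<le> ?hs ! i" if i: "Suc i < length ?hs" for i
  proof -
    obtain p q where "p \<in> P" "fst p = left + int i" "q \<in> P" "fst q = left + int (Suc i)"
      using column_nonempty_iff[of "left + int i"] column_nonempty_iff[of "left + int (Suc i)"] i
      by (force simp: column_def)
    then obtain y where "y \<in> column P (left + int i)" "y \<in> column P (left + int (Suc i))"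
      using polyomino_crossing[OF fibonacci_polyomino_imp_polyomino, of p "left + int i" q]
      by (auto simp: column_def add_ac)
    then show ?thesis
      using column_fibonacci_polyomino[of i] column_fibonacci_polyomino[of "Suc i"] i by auto
  qed
  ultimately show ?thesis
    using nonempty by (auto simp: fibonacci_heights_def in_set_conv_nth nth_butlast)
qed

lemma fibonacci_polyomino_eq_translate_staircase:
  "P = translate (left, bottom) (staircase (column_heights P))"
proof -
  let ?hs = "column_heights P"
  have "column P x = column (translate (left, bottom) (staircase ?hs)) x" for x
  proof (cases "x \<in> {left..<left + int (length ?hs)}")
    case True
    define i where "i = nat (x - left)"
    have "x = left + int i" "i < length ?hs" using True by (auto simp: i_def)
    then show ?thesis
      by (simp add: column_fibonacci_polyomino column_translate column_staircase add_ac)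
  next
    case False
    then have "column P x = {}" using column_nonempty_iff by blast
    with False show ?thesis by (auto simp: column_translate column_staircase)
  qed
  then show ?thesis by (auto simp: column_def set_eq_iff)
qed

end

lemma bij_betw_quotient:
  assumes "equiv UNIV r"
    and "\<And>a b. a \<in> A \<Longrightarrow> b \<in> A \<Longrightarrow> (f a, f b) \<in> r \<Longrightarrow> a = b"
    and "f ` A \<subseteq> X"
    and "\<And>x. x \<in> X \<Longrightarrow> \<exists>a\<in>A. (f a, x) \<in> r"
  shows "bij_betw (\<lambda>a. r `` {f a}) A (X // r)"
proof (rule bij_betw_imageI)
  show "inj_on (\<lambda>a. r `` {f a}) A"
    using assms(2) eq_equiv_class[OF _ assms(1)] by (auto intro!: inj_onI)
  show "(\<lambda>a. r `` {f a}) ` A = X // r"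
  proof (intro equalityI subsetI)
    fix C assume "C \<in> X // r"
    then obtain x where "x \<in> X" "C = r `` {x}" by (rule quotientE)
    then show "C \<in> (\<lambda>a. r `` {f a}) ` A"
      using assms(4) equiv_class_eq[OF assms(1)] by blast
  qed (use assms(3) in \<open>auto intro: quotientI\<close>)
qed

definition height_sequences :: "nat \<Rightarrow> nat \<Rightarrow> nat list set" where
  "height_sequences m n = {hs. fibonacci_heights hs \<and> length hs = m \<and> ascent 1 hs = n}"

lemma staircase_mem_fib_polyominoes_iff:
  assumes "fibonacci_heights hs"
  shows "staircase hs \<in> fib_polyominoes m n \<longleftrightarrow> hs \<in> height_sequences m n"
  using assms fibonacci_heights_ge_1[OF assms]
  by (simp add: fib_polyominoes_def height_sequences_def fibonacci_polyomino_staircase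
      horizontal_semiperimeter_staircase vertical_semiperimeter_staircase)

lemma bij_betw_fib_polyominoes:
  "bij_betw (\<lambda>hs. translation_rel `` {staircase hs})
     {hs \<in> height_sequences m n. R (last hs)}
     ({P \<in> fib_polyominoes m n. R (last_column_height P)} // translation_rel)"
  (is "bij_betw _ ?H (?X // _)")
proof (rule bij_betw_quotient[OF equiv_translation_rel])
  fix hs hs' assume hs: "hs \<in> ?H" "hs' \<in> ?H" and "(staircase hs, staircase hs') \<in> translation_rel"
  then obtain v where "staircase hs' = translate v (staircase hs)"
    by (auto simp: translation_rel_def)
  then have "column_heights (staircase hs') = column_heights (staircase hs)"
    using hs
    by (simp add: column_heights_translate finite_staircase staircase_nonempty height_sequences_def)
  then show "hs = hs'"
    using hs by (simp add: height_sequences_def column_heights_staircase)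
next
  show "staircase ` ?H \<subseteq> ?X"
    by (auto simp: staircase_mem_fib_polyominoes_iff last_column_height_staircase
        height_sequences_def)
next
  fix P assume P: "P \<in> ?X"
  define hs where "hs = column_heights P"
  have "fibonacci_polyomino P" using P by (simp add: fib_polyominoes_def)
  then have hs: "fibonacci_heights hs"
    unfolding hs_def by (rule fibonacci_heights_column_heights)
  obtain v where v: "P = translate v (staircase hs)"
    using fibonacci_polyomino_eq_translate_staircase[OF \<open>fibonacci_polyomino P\<close>]
    by (auto simp: hs_def)
  have "staircase hs \<in> ?X"
    using P hs unfolding v
    by (simp add: fib_polyominoes_def fibonacci_polyomino_staircase
        horizontal_semiperimeter_translate vertical_semiperimeter_translate
        last_column_height_translate finite_staircase staircase_nonempty)
  then have "hs \<in> ?H"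
    using hs by (simp add: staircase_mem_fib_polyominoes_iff last_column_height_staircase)
  then show "\<exists>hs\<in>?H. (staircase hs, P) \<in> translation_rel"
    using v unfolding translation_rel_def by blast
qed

corollary card_fib_polyominoes:
  "card ({P \<in> fib_polyominoes m n. R (last_column_height P)} // translation_rel)
    = card {hs \<in> height_sequences m n. R (last hs)}"
  by (rule bij_betw_same_card[OF bij_betw_fib_polyominoes, symmetric])

section \<open>The enumeration\<close>

lemma height_sequences_last_ge_2:
  "{hs \<in> height_sequences (Suc k) (Suc N). 2 \<le> last hs} = tall_lists (Suc k) N"
proof -
  have "hs \<in> height_sequences (Suc k) (Suc N) \<and> 2 \<le> last hs \<longleftrightarrow> hs \<in> tall_lists (Suc k) N" for hs
  proof (cases hs rule: rev_cases)
    case (snoc gs h)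
    then show ?thesis
      using ascent_1_eq_Suc_ascent_2[of hs]
      by (auto simp: height_sequences_def tall_lists_def fibonacci_heights_def)
  qed (simp add: height_sequences_def tall_lists_def)
  then show ?thesis by blast
qed

lemma height_sequences_last_eq_1:
  "{hs \<in> height_sequences (Suc k) (Suc N). last hs = 1} = (\<lambda>gs. gs @ [1]) ` tall_lists k N"
proof -
  have ascent: "ascent 1 (gs @ [1]) = Suc (ascent 2 gs)" if "\<forall>g\<in>set gs. 2 \<le> g" for gs
  proof (cases "gs = []")
    case False
    then have "2 \<le> last gs" using that by simp
    then show ?thesis
      using False that ascent_1_eq_Suc_ascent_2[of gs] by (simp add: ascent_append numeral_2_eq_2)
  qed simp
  have "hs \<in> height_sequences (Suc k) (Suc N) \<and> last hs = 1
      \<longleftrightarrow> hs \<in> (\<lambda>gs. gs @ [1]) ` tall_lists k N" for hs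
  proof (cases hs rule: rev_cases)
    case (snoc gs h)
    then show ?thesis
      using ascent[of gs] by (auto simp: height_sequences_def tall_lists_def fibonacci_heights_def)
  qed (auto simp: height_sequences_def)
  then show ?thesis by blast
qed

lemma height_sequences_split:
  "height_sequences m n
    = {hs \<in> height_sequences m n. 2 \<le> last hs} \<union> {hs \<in> height_sequences m n. last hs = 1}"
  by (auto simp: height_sequences_def fibonacci_heights_def)

context
  fixes m n :: nat
  assumes m_ge_1: "1 \<le> m" and n_ge_2: "2 \<le> n"
begin

lemma card_height_sequences_last_ge_2:
  "real (card {hs \<in> height_sequences m n. 2 \<le> last hs})
    = catalan m * real (binom (n - 2) (int m - 1))"
  using height_sequences_last_ge_2[of "m - 1" "n - 1"] card_tall_lists[of "n - 1" m] m_ge_1 n_ge_2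
  by (simp add: numeral_2_eq_2)

lemma card_height_sequences_last_eq_1:
  "real (card {hs \<in> height_sequences m n. last hs = 1})
    = catalan (m - 1) * real (binom (n - 2) (int m - 2))"
  using height_sequences_last_eq_1[of "m - 1" "n - 1"] card_tall_lists[of "n - 1" "m - 1"]
    m_ge_1 n_ge_2
  by (simp add: numeral_2_eq_2 card_image inj_on_def of_nat_diff)

lemma finite_height_sequences: "finite (height_sequences m n)"
proof -
  have "finite ({hs \<in> height_sequences m n. 2 \<le> last hs}
      \<union> {hs \<in> height_sequences m n. last hs = 1})"
    using height_sequences_last_ge_2[of "m - 1" "n - 1"]
      height_sequences_last_eq_1[of "m - 1" "n - 1"] m_ge_1 n_ge_2
    by (simp add: finite_tall_lists)
  then show ?thesis by (subst height_sequences_split)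
qed

lemma card_height_sequences:
  "real (card (height_sequences m n)) = catalan m * real (binom (n - 2) (int m - 1))
     + catalan (m - 1) * real (binom (n - 2) (int m - 2))"
proof -
  have "card (height_sequences m n) = card {hs \<in> height_sequences m n. 2 \<le> last hs}
      + card {hs \<in> height_sequences m n. last hs = 1}"
    by (subst height_sequences_split) (rule card_Un_disjoint, auto simp: finite_height_sequences)
  then show ?thesis
    by (simp only: of_nat_add card_height_sequences_last_ge_2 card_height_sequences_last_eq_1)
qed

end

theorem theorem3p2:
  shows "(\<forall>m n :: nat. m \<ge> 1 \<longrightarrow> n \<ge> 2 \<longrightarrow>
       finite (fib_polyominoes m n // translation_rel) \<and>
       real (num_fib_polyominoes m n) = catalan m * real (binom (n - 2) (int m - 1))
                    + catalan (m - 1) * real (binom (n - 2) (int m - 2)) \<and>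
       real (card ({P \<in> fib_polyominoes m n. last_column_height P \<ge> 2} // translation_rel))
         = catalan m * real (binom (n - 2) (int m - 1)) \<and>
       real (card ({P \<in> fib_polyominoes m n. last_column_height P = 1} // translation_rel))
         = catalan (m - 1) * real (binom (n - 2) (int m - 2)))
     \<and> (\<forall>n :: nat. n \<ge> 2 \<longrightarrow> real (num_fib_polyominoes n n) = catalan (n - 1))"
proof -
  have num_eq: "num_fib_polyominoes m n = card (height_sequences m n)" for m n
    using card_fib_polyominoes[of m n "\<lambda>_. True"] by (simp add: num_fib_polyominoes_def)
  have finite_quotient: "finite (fib_polyominoes m n // translation_rel)" if "1 \<le> m" "2 \<le> n" for m n
    using bij_betw_finite[OF bij_betw_fib_polyominoes[of m n "\<lambda>_. True"]]
      finite_height_sequences[OF that] by simp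
  have "real (num_fib_polyominoes n n) = catalan (n - 1)" if "2 \<le> n" for n
  proof -
    have "nat (int n - 1) = Suc (n - 2)" "nat (int n - 2) = n - 2" using that by simp_all
    then show ?thesis using card_height_sequences[of n n] that by (simp add: num_eq binom_def)
  qed
  then show ?thesis
    by (auto simp only: num_eq finite_quotient card_height_sequences
        card_fib_polyominoes[of _ _ "\<lambda>h. 2 \<le> h"] card_height_sequences_last_ge_2
        card_fib_polyominoes[of _ _ "\<lambda>h. h = 1"] card_height_sequences_last_eq_1)
qed

end
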